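(* Let $k\in\mathbb N$ and fix $\eta>0$. Then there exists a missing-digit fractal $\mathcal K\subseteq[0,1]^k$ with $\mathcal K\supseteq[0,1]^{k-1}\times\{0\}$ such that \[ \#\mathcal N_{\mathcal K}(Q,0)\ll Q^{k+\eta}\quad(Q\geqslant1)\qquad\text{and}\qquad \dim_{\mathrm H}(\mathcal K)>k-\eta. \]
   Context: A missing-digit fractal is a set $\mathcal K_{b,\mathcal D}=\{\sum_{j\geqslant1}\mathbf d^{(j)}b^{-j}:\mathbf d^{(j)}\in\mathcal D\}\subseteq[0,1]^k$ with integers $b\geqslant2$ and nonempty $\mathcal D\subseteq\{0,1,\dots,b-1\}^k$. $\dim_{\mathrm H}$ is Hausdorff dimension. $\mathcal N_{\mathcal K}(Q,0)=\{(\mathbf a,q)\in\mathbb Z^k\times(\mathbb Z\cap[1,Q]):\ \mathbf a/q\in\mathcal K\}$. *)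

theory Defs
  imports "HOL-Analysis.Analysis"
begin

text \<open>Missing-digit fractal K_{b,D} in [0,1]^k, with k = CARD('n).
  A digit is a vector d :: 'n \<Rightarrow> nat with entries in {0..b-1}; the point
  is sum_{j>=1} d^{(j)} b^{-j}, i.e. coordinatewise series (index j shifted by one).\<close>
definition missing_digit_set :: "nat \<Rightarrow> ('n::finite \<Rightarrow> nat) set \<Rightarrow> (real ^ 'n) set" where
  "missing_digit_set b D =
     {x. \<exists>d :: nat \<Rightarrow> ('n \<Rightarrow> nat). (\<forall>j. d j \<in> D) \<and>
          (\<forall>i. (\<lambda>j. real (d j i) / real b ^ Suc j) sums (x $ i))}"

definition is_missing_digit_fractal :: "(real ^ 'n::finite) set \<Rightarrow> bool" where
  "is_missing_digit_fractal K \<longleftrightarrow>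
     (\<exists>b D. b \<ge> 2 \<and> D \<noteq> {} \<and> (\<forall>d\<in>D. \<forall>i. d i < b) \<and> K = missing_digit_set b D)"

definition hausdorff_delta :: "real \<Rightarrow> real \<Rightarrow> 'a::metric_space set \<Rightarrow> ennreal" where
  "hausdorff_delta s \<delta> A =
     (INF C \<in> {C :: nat \<Rightarrow> 'a set. A \<subseteq> (\<Union>n. C n) \<and> (\<forall>n. bounded (C n) \<and> diameter (C n) \<le> \<delta>)}.
        (\<Sum>n. ennreal (diameter (C n) powr s)))"

definition hausdorff_measure :: "real \<Rightarrow> 'a::metric_space set \<Rightarrow> ennreal" where
  "hausdorff_measure s A = (SUP \<delta> \<in> {0<..}. hausdorff_delta s \<delta> A)"

definition hausdorff_dim :: "'a::metric_space set \<Rightarrow> ereal" where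
  "hausdorff_dim A = Inf {ereal s | s. s > 0 \<and> hausdorff_measure s A = 0}"

definition rational_points :: "(real ^ 'n::finite) set \<Rightarrow> real \<Rightarrow> (('n \<Rightarrow> int) \<times> nat) set" where
  "rational_points K Q = {(a, q). 1 \<le> q \<and> real q \<le> Q \<and> (\<chi> i. real_of_int (a i) / real q) \<in> K}"

end

theory Submission
  imports Defs "HOL-Computational_Algebra.Primes" "HOL-Library.Real_Mod"
begin

text \<open>
  Take \<open>K = [0,1]^(k-1) \<times> K'\<close>, where \<open>K'\<close> consists of the numbers whose base-\<open>b\<close> digits are all
  smaller than \<open>c = b^(1 - 1/R)\<close>, with \<open>R > 1/\<eta>\<close> fixed and \<open>b\<close> large.

  Counting: choose \<open>M\<close> with \<open>b = 8 M c\<close> and let \<open>S\<close> be the set of integers with \<open>t\<close> base-\<open>b\<close>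
  digits, all smaller than \<open>M\<close>. Every \<open>y \<in> K'\<close> satisfies \<open>b^j y mod 1 \<le> 1/(8 M)\<close> for all \<open>j\<close>, so
  the exponential sum of \<open>S\<close> at \<open>y\<close> factorises into \<open>t\<close> sums without cancellation and has modulus at
  least \<open>(M/2)^t\<close>. By Parseval modulo \<open>q\<close>, the number of \<open>a mod q\<close> with \<open>a/q \<in> K'\<close> is at most
  \<open>4^t q M^(-2t)\<close> times the number of pairs in \<open>S \<times> S\<close> that are congruent modulo \<open>q\<close>. Summing over
  \<open>q \<le> Q\<close>, the diagonal contributes \<open>4^t Q^2 / M^t\<close> and the other pairs contribute at most
  \<open>4^t Q\<close> times the largest number of divisors below \<open>b^t\<close>. With \<open>M^t\<close> of size \<open>Q\<close> both are
  \<open>O(Q^(1+\<eta>))\<close> once \<open>M\<close> is large, since then \<open>4^t\<close> is a small power of \<open>Q\<close>.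

  Dimension: reading base-\<open>b\<close> digits in base \<open>c\<close> maps \<open>K'\<close> onto \<open>[0,1]\<close> and is Hoelder of exponent
  \<open>1 - 1/R\<close>. A cover of \<open>K\<close> is thereby turned into a cover of the unit cube by boxes, whose total
  Lebesgue measure is at least 1.
\<close>

section \<open>The divisor bound\<close>

lemma card_divisors_mult_le:
  fixes m n :: nat
  assumes "m > 0" "n > 0"
  shows "card {d. d dvd m * n} \<le> card {d. d dvd m} * card {d. d dvd n}"
proof -
  have "{d. d dvd m * n} \<subseteq> (\<lambda>(x, y). x * y) ` ({d. d dvd m} \<times> {d. d dvd n})"
    by (force dest: division_decomp)
  then have "card {d. d dvd m * n} \<le> card ({d. d dvd m} \<times> {d. d dvd n})"
    using assms by (intro surj_card_le finite_cartesian_product) (auto simp: finite_divisors_nat)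
  then show ?thesis by (simp only: card_cartesian_product)
qed

lemma card_divisors_prime_power:
  fixes p :: nat
  assumes "prime p"
  shows "card {d. d dvd p ^ e} \<le> Suc e"
proof -
  have "{d. d dvd p ^ e} = (\<lambda>i. p ^ i) ` {..e}"
    using assms by (auto simp: divides_primepow_nat)
  then show ?thesis
    using card_image_le[of "{..e}" "\<lambda>i. p ^ i"] by simp
qed

text \<open>Strip from \<open>n\<close> the full power \<open>p ^ e\<close> of one prime at a time.
  The divisor count then drops by a factor of at most \<open>e + 1\<close>, which is at most
  \<open>(p ^ e) powr \<epsilon>\<close> for large \<open>p\<close> and at most \<open>K\<close>
  times that for the finitely many small \<open>p\<close>.\<close>

lemma divisor_bound:
  fixes \<epsilon> :: real
  assumes "\<epsilon> > 0"
  obtains C where "C > 0" "\<And>n::nat. n > 0 \<Longrightarrow> real (card {d. d dvd n}) \<le> C * real n powr \<epsilon>"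
proof -
  \<comment> \<open>With x = \<open>\<epsilon> * e * ln 2\<close>, this choice gives e + 1 \<le> K
    (1 + x) \<le> K exp x, and exp x = 2 powr (\<epsilon> e). The maximum with 1 makes powers of
    \<open>K\<close> increasing.\<close>
  define K where "K = max 1 (1 / (\<epsilon> * ln 2))"
  have K1: "K \<ge> 1" by (simp add: K_def)
  have K: "real (Suc e) \<le> K * 2 powr (\<epsilon> * real e)" for e
  proof -
    have p: "\<epsilon> * ln 2 > 0" using assms by simp
    have "real e = (1 / (\<epsilon> * ln 2)) * (\<epsilon> * ln 2 * real e)" using assms by simp
    also have "\<dots> \<le> K * (\<epsilon> * ln 2 * real e)"
      using p by (intro mult_right_mono) (auto simp: K_def)
    finally have "real (Suc e) \<le> K * (1 + \<epsilon> * real e * ln 2)"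
      using K1 by (simp add: algebra_simps)
    also have "\<dots> \<le> K * 2 powr (\<epsilon> * real e)"
      using K1 by (intro mult_left_mono) (auto simp: powr_def)
    finally show ?thesis .
  qed
  \<comment> \<open>From \<open>B\<close> on, \<open>p powr \<epsilon> \<ge> 2\<close>, so e + 1
    \<le> 2^e \<le> (p^e) powr \<epsilon> without any constant.\<close>
  define B where "B = nat \<lceil>2 powr (1 / \<epsilon>)\<rceil>"
  have B: "2 \<le> real p powr \<epsilon>" if "p \<ge> B" for p
  proof -
    have "2 powr (1 / \<epsilon>) \<le> real p" using that unfolding B_def by linarith
    then have "(2 powr (1 / \<epsilon>)) powr \<epsilon> \<le> real p powr \<epsilon>"
      using assms by (intro powr_mono2) auto
    then show ?thesis using assms by (simp add: powr_powr)
  qed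
  \<comment> \<open>The small primes dividing \<open>n\<close>: the induction pays one factor
    \<open>K\<close> for each, hence at most \<open>K ^ B\<close> altogether.\<close>
  define P where "P n = {p. prime p \<and> p dvd n \<and> p < B}" for n
  have finP: "finite (P n)" for n
    by (rule finite_subset[of _ "{..<B}"]) (auto simp: P_def)
  have main: "real (card {d. d dvd n}) \<le> K ^ card (P n) * real n powr \<epsilon>" if "n > 0" for n
    using that
  proof (induction n rule: less_induct)
    case (less n)
    show ?case
    proof (cases "n = 1")
      case True
      then have "{d. d dvd n} = {1}" by auto
      then show ?thesis using K1 True by simp
    next
      case False
      then obtain p where p: "prime p" "p dvd n" using prime_factor_nat by blast
      define e where "e = multiplicity p n"
      obtain m where m: "n = p ^ e * m" "\<not> p dvd m"
        using multiplicity_decompose'[of n p] less.prems p unfolding e_def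
        by (metis neq0_conv not_prime_unit)
      have "e > 0"
        unfolding e_def using p less.prems by (simp add: prime_multiplicity_gt_zero_iff)
      have "m > 0" using m less.prems by (cases m) auto
      have "p ^ e > 1" using \<open>e > 0\<close> p prime_gt_1_nat by (metis one_less_power)
      then have "m < n" using m \<open>m > 0\<close> by simp
      then have IH: "real (card {d. d dvd m}) \<le> K ^ card (P m) * real m powr \<epsilon>"
        using less.IH \<open>m > 0\<close> by blast
      have pn: "real (p ^ e) powr \<epsilon> = (real p powr \<epsilon>) ^ e"
        using p prime_gt_0_nat[of p]
        by (simp add: powr_power powr_powr powr_realpow[symmetric] mult.commute)
      define j where "j = (if p < B then 1 else 0 :: nat)"
      have e: "real (Suc e) \<le> K ^ j * real (p ^ e) powr \<epsilon>"
      proof (cases "p < B")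
        case True
        have "(2 powr \<epsilon>) ^ e \<le> (real p powr \<epsilon>) ^ e"
          using prime_ge_2_nat[OF p(1)] assms by (intro power_mono powr_mono2) auto
        then have "2 powr (\<epsilon> * real e) \<le> real (p ^ e) powr \<epsilon>"
          unfolding pn by (simp add: powr_power mult.commute)
        then have "K * 2 powr (\<epsilon> * real e) \<le> K * real (p ^ e) powr \<epsilon>"
          using K1 by (intro mult_left_mono) auto
        then show ?thesis using K[of e] True by (simp add: j_def)
      next
        case False
        have "real (Suc e) \<le> 2 ^ e"
          by (metis less_exp of_nat_le_iff of_nat_numeral of_nat_power Suc_leI)
        also have "\<dots> \<le> (real p powr \<epsilon>) ^ e"
          using B[of p] False by (intro power_mono) auto
        finally show ?thesis unfolding pn using False by (simp add: j_def)
      qed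
      have Pn: "card (P m) + j \<le> card (P n)"
      proof (cases "p < B")
        case True
        then have "insert p (P m) \<subseteq> P n" "p \<notin> P m"
          using p m by (auto simp: P_def)
        then have "card (insert p (P m)) \<le> card (P n)" using finP card_mono by blast
        then show ?thesis using \<open>p \<notin> P m\<close> finP True by (simp add: j_def)
      next
        case False
        have "P m \<subseteq> P n" using m by (auto simp: P_def)
        then show ?thesis using False card_mono[OF finP] by (simp add: j_def)
      qed
      have "card {d. d dvd n} \<le> card {d. d dvd p ^ e} * card {d. d dvd m}"
        unfolding m(1) using prime_gt_0_nat[OF p(1)] \<open>m > 0\<close> by (intro card_divisors_mult_le) auto
      also have "\<dots> \<le> Suc e * card {d. d dvd m}"
        using card_divisors_prime_power[OF p(1)] by (intro mult_right_mono) auto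
      finally have "real (card {d. d dvd n}) \<le> real (Suc e) * real (card {d. d dvd m})"
        by (metis of_nat_le_iff of_nat_mult)
      also have "\<dots> \<le> (K ^ j * real (p ^ e) powr \<epsilon>) * (K ^ card (P m) * real m powr \<epsilon>)"
        using K1 by (intro mult_mono e IH) auto
      also have "\<dots> = K ^ (card (P m) + j) * real n powr \<epsilon>"
        unfolding m(1) by (simp add: powr_mult power_add)
      also have "\<dots> \<le> K ^ card (P n) * real n powr \<epsilon>"
        using K1 Pn by (intro mult_right_mono power_increasing) auto
      finally show ?thesis .
    qed
  qed
  have "real (card {d. d dvd n}) \<le> K ^ B * real n powr \<epsilon>" if "n > 0" for n
  proof -
    have "card (P n) \<le> card {..<B}" by (intro card_mono) (auto simp: P_def)
    then have "K ^ card (P n) \<le> K ^ B" using K1 by (intro power_increasing) auto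
    then have "K ^ card (P n) * real n powr \<epsilon> \<le> K ^ B * real n powr \<epsilon>"
      by (intro mult_right_mono) auto
    then show ?thesis using main[OF that] by linarith
  qed
  moreover have "K ^ B > 0" using K1 by simp
  ultimately show thesis using that by blast
qed

section \<open>Digit expansions\<close>

definition digit_set :: "nat \<Rightarrow> nat \<Rightarrow> real set" where
  "digit_set b c = {x. \<exists>d. (\<forall>j. d j < c) \<and> (\<lambda>j. real (d j) / real b ^ Suc j) sums x}"

text \<open>A digit set that is a product lets the coordinates choose their digits independently, so
  the fractal is a product as well.\<close>

lemma missing_digit_set_box:
  "missing_digit_set b {d. \<forall>i. d i < g i} = {x. \<forall>i. x $ i \<in> digit_set b (g i)}"
proof (intro equalityI subsetI)
  fix x assume "x \<in> missing_digit_set b {d. \<forall>i. d i < g i}"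
  then obtain d where "\<forall>j i. d j i < g i"
      "\<forall>i. (\<lambda>j. real (d j i) / real b ^ Suc j) sums (x $ i)"
    by (auto simp: missing_digit_set_def)
  then show "x \<in> {x. \<forall>i. x $ i \<in> digit_set b (g i)}"
    unfolding digit_set_def by (auto intro!: exI[of _ "\<lambda>j. d j _"])
next
  fix x assume "x \<in> {x. \<forall>i. x $ i \<in> digit_set b (g i)}"
  then have "\<forall>i. \<exists>d. (\<forall>j. d j < g i) \<and> (\<lambda>j. real (d j) / real b ^ Suc j) sums (x $ i)"
    by (auto simp: digit_set_def)
  then obtain d where "\<forall>i. (\<forall>j. d i j < g i) \<and> (\<lambda>j. real (d i j) / real b ^ Suc j) sums (x $ i)"
    by metis
  then show "x \<in> missing_digit_set b {d. \<forall>i. d i < g i}"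
    unfolding missing_digit_set_def by (auto intro!: exI[of _ "\<lambda>j i. d i j"])
qed

text \<open>The extreme case has all digits equal to c - 1 and sums to (c - 1)/(b - 1), which is at
  most c/b because c \<le> b.\<close>

lemma digit_expansion_bounds:
  assumes "b \<ge> 2" "c \<le> b" "\<And>j. d j < c" "(\<lambda>j. real (d j) / real b ^ Suc j) sums x"
  shows "0 \<le> x" "x \<le> real c / real b"
proof -
  show "0 \<le> x"
    by (rule sums_le[OF _ sums_zero assms(4)]) simp
  have c: "c \<ge> 1" using assms(3)[of 0] by simp
  have "(\<lambda>j. (1 / real b) ^ j) sums (1 / (1 - 1 / real b))"
    using assms(1) by (intro geometric_sums) auto
  then have up: "(\<lambda>j. (real c - 1) / real b * (1 / real b) ^ j) sums
      ((real c - 1) / real b * (1 / (1 - 1 / real b)))"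
    by (rule sums_mult)
  have le: "real (d j) / real b ^ Suc j \<le> (real c - 1) / real b * (1 / real b) ^ j" for j
  proof -
    have "real (d j) \<le> real c - 1" using assms(3)[of j] by linarith
    then show ?thesis using assms(1) by (simp add: field_simps power_one_over)
  qed
  have "x \<le> (real c - 1) / real b * (1 / (1 - 1 / real b))"
    by (rule sums_le[OF le assms(4) up])
  also have "\<dots> = (real c - 1) / (real b - 1)"
    using assms(1) by (simp add: field_simps)
  also have "\<dots> \<le> real c / real b"
    using assms(1,2) c by (simp add: field_simps)
  finally show "x \<le> real c / real b" .
qed

text \<open>The self-similarity behind the inductions on digits below: the shifted sequence again
  uses only allowed digits.\<close>

lemma digit_expansion_shift:
  assumes "b > 0" "(\<lambda>j. real (d j) / real b ^ Suc j) sums x"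
  shows "(\<lambda>j. real (d (Suc j)) / real b ^ Suc j) sums (real b * x - real (d 0))"
proof -
  have "(\<lambda>j. real (d (Suc j)) / real b ^ Suc (Suc j)) sums (x - real (d 0) / real b)"
    using assms(2) sums_Suc_iff[of "\<lambda>j. real (d j) / real b ^ Suc j"] by simp
  then have "(\<lambda>j. real b * (real (d (Suc j)) / real b ^ Suc (Suc j))) sums
      (real b * (x - real (d 0) / real b))"
    by (rule sums_mult)
  then show ?thesis using assms(1) by (simp add: algebra_simps)
qed

lemma digit_expansion_exists:
  assumes "b \<ge> 2" "0 \<le> x" "x \<le> 1"
  shows "\<exists>d. (\<forall>j. d j < b) \<and> (\<lambda>j. real (d j) / real b ^ Suc j) sums x"
proof -
  \<comment> \<open>Greedy digit. The minimum matters only at y = 1, where the floor would be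
    \<open>b\<close>; there the digit b - 1 leaves the remainder 1 again, so remainders stay in
    [0,1].\<close>
  define D where "D y = nat (min \<lfloor>real b * y\<rfloor> (int b - 1))" for y :: real
  define y where "y = rec_nat x (\<lambda>_ u. real b * u - real (D u))"
  have y_Suc: "y (Suc n) = real b * y n - real (D (y n))" and y_0: "y 0 = x" for n
    by (auto simp: y_def)
  have D: "D u < b \<and> 0 \<le> real b * u - real (D u) \<and> real b * u - real (D u) \<le> 1"
    if "0 \<le> u" "u \<le> 1" for u
  proof -
    have p: "0 \<le> real b * u" "real b * u \<le> real b"
      using that by (auto simp: mult_left_le)
    have "real (D u) = real_of_int (min \<lfloor>real b * u\<rfloor> (int b - 1))"
      using p assms(1) by (simp add: D_def)
    moreover have "D u < b" using assms(1) unfolding D_def by linarith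
    moreover have "0 \<le> min \<lfloor>real b * u\<rfloor> (int b - 1)" using p assms(1) by simp
    ultimately show ?thesis using p by linarith
  qed
  have y: "0 \<le> y n \<and> y n \<le> 1" for n
    by (induction n) (use assms D in \<open>auto simp: y_0 y_Suc\<close>)
  have part: "(\<Sum>j<n. real (D (y j)) / real b ^ Suc j) = x - y n / real b ^ n" for n
  proof (induction n)
    case (Suc n)
    then show ?case using assms(1) by (simp add: y_Suc diff_divide_distrib)
  qed (simp add: y_0)
  have "(\<lambda>n. y n / real b ^ n) \<longlonglongrightarrow> 0"
  proof (rule tendsto_sandwich[where f = "\<lambda>_. 0" and h = "\<lambda>n. (1 / real b) ^ n"])
    show "(\<lambda>n. (1 / real b) ^ n) \<longlonglongrightarrow> 0"
      using assms(1) by (intro LIMSEQ_realpow_zero) auto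
    show "\<forall>\<^sub>F n in sequentially. y n / real b ^ n \<le> (1 / real b) ^ n"
      using y by (auto simp: power_one_over field_simps intro!: always_eventually divide_right_mono)
    show "\<forall>\<^sub>F n in sequentially. 0 \<le> y n / real b ^ n"
      using y by (auto intro!: always_eventually)
  qed simp
  then have "(\<lambda>n. x - y n / real b ^ n) \<longlonglongrightarrow> x - 0"
    by (intro tendsto_diff tendsto_const)
  then have "(\<lambda>j. real (D (y j)) / real b ^ Suc j) sums x"
    by (simp only: sums_def part diff_zero)
  then show ?thesis using D y by (intro exI[of _ "\<lambda>j. D (y j)"]) auto
qed

lemma digit_set_full:
  assumes "b \<ge> 2"
  shows "digit_set b b = {0..1}"
proof (intro equalityI subsetI)
  fix x assume "x \<in> digit_set b b"
  then obtain d where "\<And>j. d j < b" "(\<lambda>j. real (d j) / real b ^ Suc j) sums x"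
    by (auto simp: digit_set_def)
  from digit_expansion_bounds[OF assms order_refl this] show "x \<in> {0..1}"
    using assms by simp
next
  fix x :: real assume "x \<in> {0..1}"
  then show "x \<in> digit_set b b"
    using digit_expansion_exists[OF assms] by (simp add: digit_set_def)
qed

text \<open>As 2c \<le> b, what remains after removing a leading digit lies in [0,1/2]. Points
  closer than 1/(2 b^n) with n \<ge> 1 therefore share their leading digit, and shifting repeats the
  argument. So the first n digits agree, and in base \<open>c\<close> this means distance at most
  c^(-n).\<close>

lemma digit_change_of_base_close:
  assumes "c \<ge> 2" "2 * c \<le> b" "\<And>j. d j < c" "\<And>j. e j < c"
    and "(\<lambda>j. real (d j) / real b ^ Suc j) sums x" "(\<lambda>j. real (e j) / real b ^ Suc j) sums y"
    and "(\<lambda>j. real (d j) / real c ^ Suc j) sums u" "(\<lambda>j. real (e j) / real c ^ Suc j) sums v"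
    and "\<bar>x - y\<bar> < 1 / (2 * real b ^ n)"
  shows "\<bar>u - v\<bar> \<le> 1 / real c ^ n"
  using assms(3-)
proof (induction n arbitrary: d e x y u v)
  case 0
  have "0 \<le> u" "u \<le> 1" "0 \<le> v" "v \<le> 1"
    using digit_expansion_bounds[OF assms(1) order_refl 0(1) 0(5)]
      digit_expansion_bounds[OF assms(1) order_refl 0(2) 0(6)] assms(1) by auto
  then show ?case by simp
next
  case (Suc n)
  have b: "b \<ge> 2" "c \<le> b" "0 < b" "0 < c" using assms by auto
  let ?x = "real b * x - real (d 0)" and ?y = "real b * y - real (e 0)"
  let ?u = "real c * u - real (d 0)" and ?v = "real c * v - real (e 0)"
  note shifts = digit_expansion_shift[OF b(3) Suc.prems(3)] digit_expansion_shift[OF b(3) Suc.prems(4)]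
    digit_expansion_shift[OF b(4) Suc.prems(5)] digit_expansion_shift[OF b(4) Suc.prems(6)]
  have cb: "real c / real b \<le> 1 / 2" using assms(1,2) by (simp add: field_simps)
  have bounds: "0 \<le> ?x" "?x \<le> 1 / 2" "0 \<le> ?y" "?y \<le> 1 / 2"
    using digit_expansion_bounds[OF b(1,2) Suc.prems(1) shifts(1)]
      digit_expansion_bounds[OF b(1,2) Suc.prems(2) shifts(2)] cb by linarith+
  have "\<bar>real b * x - real b * y\<bar> = real b * \<bar>x - y\<bar>"
    by (simp add: abs_mult flip: right_diff_distrib)
  also have "\<dots> < real b * (1 / (2 * real b ^ Suc n))"
    using Suc.prems(7) b by (intro mult_strict_left_mono) auto
  also have "\<dots> = 1 / (2 * real b ^ n)" using b by simp
  finally have close: "\<bar>real b * x - real b * y\<bar> < 1 / (2 * real b ^ n)" .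
  have "1 / (2 * real b ^ n) \<le> 1 / 2"
    using b by (simp add: field_simps)
  then have "\<bar>real (d 0) - real (e 0)\<bar> < 1" using close bounds by linarith
  then have eq: "d 0 = e 0" by linarith
  have "\<bar>?u - ?v\<bar> \<le> 1 / real c ^ n"
    using close eq by (intro Suc.IH[OF _ _ shifts]) (auto simp: Suc.prems(1,2))
  then have "real c * \<bar>u - v\<bar> \<le> 1 / real c ^ n"
    using eq by (simp add: abs_mult flip: right_diff_distrib)
  then show ?case using b by (simp add: field_simps)
qed

lemma digit_change_of_base_Hoelder:
  assumes "c \<ge> 2" "2 * c \<le> b" "real c = real b powr \<delta>" "\<And>j. d j < c" "\<And>j. e j < c"
    and "(\<lambda>j. real (d j) / real b ^ Suc j) sums x" "(\<lambda>j. real (e j) / real b ^ Suc j) sums y"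
    and "(\<lambda>j. real (d j) / real c ^ Suc j) sums u" "(\<lambda>j. real (e j) / real c ^ Suc j) sums v"
    and "\<bar>x - y\<bar> \<le> r"
  shows "\<bar>u - v\<bar> \<le> (2 * real b * r) powr \<delta>"
proof -
  have b: "b \<ge> 2" "real b > 1" using assms by auto
  have \<delta>: "\<delta> > 0"
  proof (rule ccontr)
    assume "\<not> \<delta> > 0"
    then have "real b powr \<delta> \<le> real b powr 0" using b by (intro powr_mono) auto
    then show False using assms(1,3) b by simp
  qed
  note aux = digit_change_of_base_close[OF assms(1,2,4-9)]
  show ?thesis
  proof (cases "r \<le> 0")
    \<comment> \<open>Here x = y, so all digits agree and u = v: reading the digits in base
      \<open>c\<close> is well defined on points.\<close>
    case True
    then have "x = y" "r = 0" using assms(10) by auto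
    then have le: "\<bar>u - v\<bar> \<le> (1 / real c) ^ n" for n using aux[of n] b by (simp add: power_one_over)
    have "(\<lambda>n. (1 / real c) ^ n) \<longlonglongrightarrow> 0"
      using assms(1) by (intro LIMSEQ_realpow_zero) auto
    then have "\<bar>u - v\<bar> \<le> 0" using le by (intro LIMSEQ_le_const) auto
    then show ?thesis using \<open>r = 0\<close> by simp
  next
    case False
    then have r: "r > 0" by simp
    obtain N where "(1 / real b) ^ N < r"
      using real_arch_pow_inv[OF r, of "1 / real b"] b by auto
    then have ex: "1 / (2 * real b ^ Suc N) \<le> r"
    proof -
      have "real b ^ N \<le> 2 * real b ^ Suc N" using b by simp
      then have "1 / (2 * real b ^ Suc N) \<le> 1 / real b ^ N"
        using b by (intro divide_left_mono) auto
      then show ?thesis using \<open>(1 / real b) ^ N < r\<close> by (simp add: power_one_over)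
    qed
    \<comment> \<open>The scale of \<open>r\<close>: minimality gives r < 1/(2 b^n) when n > 0, so
      |u - v| \<le> c^(-n) = (b^(-n)) powr \<delta>, while the defining inequality says b^(-n) \<le>
      2 b r. For n = 0 the bound |u - v| \<le> 1 is trivial.\<close>
    define n where "n = (LEAST n. 1 / (2 * real b ^ Suc n) \<le> r)"
    have n: "1 / (2 * real b ^ Suc n) \<le> r" unfolding n_def using ex by (rule LeastI)
    have "\<bar>u - v\<bar> \<le> 1 / real c ^ n"
    proof (cases n)
      case 0
      have "0 \<le> u" "u \<le> 1" "0 \<le> v" "v \<le> 1"
        using digit_expansion_bounds[OF assms(1) order_refl assms(4,8)]
          digit_expansion_bounds[OF assms(1) order_refl assms(5,9)] assms(1) by auto
      then show ?thesis using 0 by simp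
    next
      case (Suc m)
      then have "\<not> 1 / (2 * real b ^ Suc m) \<le> r" unfolding n_def by (metis lessI not_less_Least)
      then show ?thesis using assms(10) Suc by (intro aux) auto
    qed
    also have "1 / real c ^ n = (1 / real b ^ n) powr \<delta>"
      using b by (simp add: assms(3) powr_divide powr_power powr_powr powr_realpow[symmetric] mult.commute)
    also have "\<dots> \<le> (2 * real b * r) powr \<delta>"
      using n b \<delta> by (intro powr_mono2) (auto simp: field_simps)
    finally show ?thesis .
  qed
qed

section \<open>Exponential sums over integers with small digits\<close>

text \<open>The recursion splits off the least significant digit, so that the higher digits carry
  the frequency \<open>b * y\<close> in the exponential sum.\<close>

fun digit_ints :: "nat \<Rightarrow> nat \<Rightarrow> nat \<Rightarrow> nat set" where
  "digit_ints b M 0 = {0}"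
| "digit_ints b M (Suc t) = (\<lambda>(m, n). m + b * n) ` ({..<M} \<times> digit_ints b M t)"

lemma inj_on_digit_ints:
  assumes "M \<le> b"
  shows "inj_on (\<lambda>(m, n). m + b * n) ({..<M} \<times> (A :: nat set))"
proof (rule inj_onI, clarsimp)
  fix m n m' n' :: nat
  assume *: "m < M" "m' < M" "m + b * n = m' + b * n'"
  then have "m mod b = m' mod b" by (metis mod_mult_self2)
  then have "m = m'" using * assms by simp
  then show "m = m' \<and> n = n'" using * assms by simp
qed

lemma finite_digit_ints: "finite (digit_ints b M t)"
  by (induction t) auto

lemma card_digit_ints: "M \<le> b \<Longrightarrow> card (digit_ints b M t) = M ^ t"
  by (induction t) (simp_all add: card_image inj_on_digit_ints card_cartesian_product)

lemma digit_ints_less: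
  assumes "M \<le> b" "b > 0" "n \<in> digit_ints b M t"
  shows "n < b ^ t"
  using assms(3)
proof (induction t arbitrary: n)
  case (Suc t)
  then obtain m k where mk: "n = m + b * k" "m < M" "k \<in> digit_ints b M t" by auto
  then have "k + 1 \<le> b ^ t" using Suc.IH by fastforce
  then have "b * (k + 1) \<le> b * b ^ t" by (rule mult_le_mono2)
  then show ?case using mk assms(1) by simp
qed simp

definition exp_sum :: "nat set \<Rightarrow> real \<Rightarrow> complex" where
  "exp_sum A y = (\<Sum>n\<in>A. cis (2 * pi * (real n * y)))"

text \<open>Only y modulo 1 matters, so \<open>b * y\<close> may be replaced by the point with the
  shifted expansion.\<close>

lemma exp_sum_add_nat: "exp_sum A (real m + y) = exp_sum A y"
proof -
  have "cis (2 * pi * (real n * (real m + y))) = cis (2 * pi * (real n * y))" for n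
  proof -
    have "2 * pi * (real n * (real m + y)) = 2 * pi * real (n * m) + 2 * pi * (real n * y)"
      by (simp add: algebra_simps)
    then have "cis (2 * pi * (real n * (real m + y))) =
        cis (2 * pi * real (n * m)) * cis (2 * pi * (real n * y))"
      by (metis cis_mult)
    moreover have "cis (2 * pi * real (n * m)) = 1" by (rule cis_multiple_2pi) simp
    ultimately show ?thesis by simp
  qed
  then show ?thesis by (simp add: exp_sum_def)
qed

lemma exp_sum_digit_ints_Suc:
  assumes "M \<le> b"
  shows "exp_sum (digit_ints b M (Suc t)) y = exp_sum {..<M} y * exp_sum (digit_ints b M t) (real b * y)"
proof -
  have "cis (2 * pi * (real (m + b * n) * y)) =
      cis (2 * pi * (real m * y)) * cis (2 * pi * (real n * (real b * y)))" for m n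
    by (simp add: cis_mult algebra_simps)
  then show ?thesis
    unfolding exp_sum_def digit_ints.simps sum_product sum.cartesian_product
    by (subst sum.reindex[OF inj_on_digit_ints[OF assms]]) (auto intro!: sum.cong)
qed

text \<open>All phases lie in [0, pi/3], where the cosine is at least 1/2, so the real parts do not
  cancel.\<close>

lemma norm_exp_sum_lessThan_ge:
  assumes "0 \<le> y" "6 * real M * y \<le> 1"
  shows "real M / 2 \<le> cmod (exp_sum {..<M} y)"
proof -
  have "1 / 2 \<le> cos (2 * pi * (real m * y))" if "m < M" for m
  proof -
    have "real m * y \<le> real M * y" using that assms(1) by (intro mult_right_mono) auto
    then have "2 * pi * (real m * y) \<le> 2 * pi * (1 / 6)"
      using assms(2) by (intro mult_left_mono) auto
    then have "cos (pi / 3) \<le> cos (2 * pi * (real m * y))"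
      using assms(1) by (intro cos_monotone_0_pi_le) auto
    then show ?thesis by (simp add: cos_60)
  qed
  then have "(\<Sum>m<M. 1 / 2) \<le> (\<Sum>m<M. cos (2 * pi * (real m * y)))"
    by (intro sum_mono) auto
  also have "\<dots> = Re (exp_sum {..<M} y)" by (simp add: exp_sum_def)
  also have "\<dots> \<le> cmod (exp_sum {..<M} y)" by (rule complex_Re_le_cmod)
  finally show ?thesis by simp
qed

text \<open>Each shift of \<open>y\<close> stays in \<open>digit_set b c\<close>, hence below c/b
  \<le> 1/(6M). Every one of the \<open>t\<close> factors of the exponential sum is thus at least
  M/2.\<close>

lemma norm_exp_sum_digit_ints_ge:
  assumes "b \<ge> 2" "M \<le> b" "6 * M * c \<le> b" "M > 0" "y \<in> digit_set b c"
  shows "(real M / 2) ^ t \<le> cmod (exp_sum (digit_ints b M t) y)"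
  using assms(5)
proof (induction t arbitrary: y)
  case 0
  then show ?case by (simp add: exp_sum_def)
next
  case (Suc t)
  then obtain d where d: "\<And>j. d j < c" "(\<lambda>j. real (d j) / real b ^ Suc j) sums y"
    by (auto simp: digit_set_def)
  let ?y = "real b * y - real (d 0)"
  have y': "?y \<in> digit_set b c"
    using digit_expansion_shift[of b d y] d assms(1)
    unfolding digit_set_def by (auto intro!: exI[of _ "\<lambda>j. d (Suc j)"])
  have "c \<le> 6 * M * c" using assms(4) by simp
  then have "c \<le> b" using assms(3) by linarith
  note bounds = digit_expansion_bounds[OF assms(1) this d]
  have "6 * real M * y \<le> 6 * real M * (real c / real b)"
    using bounds by (intro mult_left_mono) auto
  also have "\<dots> = real (6 * M * c) / real b" by simp
  also have "\<dots> \<le> 1" using assms(1,3) by (simp only: divide_le_eq_1 of_nat_le_iff) simp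
  finally have M: "real M / 2 \<le> cmod (exp_sum {..<M} y)"
    by (intro norm_exp_sum_lessThan_ge bounds)
  have "exp_sum (digit_ints b M t) (real b * y) = exp_sum (digit_ints b M t) ?y"
    using exp_sum_add_nat[of "digit_ints b M t" "d 0" ?y] by simp
  then have "(real M / 2) ^ t \<le> cmod (exp_sum (digit_ints b M t) (real b * y))"
    using Suc.IH[OF y'] by simp
  then have "(real M / 2) * (real M / 2) ^ t \<le>
      cmod (exp_sum {..<M} y) * cmod (exp_sum (digit_ints b M t) (real b * y))"
    using M by (intro mult_mono) auto
  then show ?case
    unfolding exp_sum_digit_ints_Suc[OF assms(2)] norm_mult by simp
qed

text \<open>Orthogonality of additive characters modulo \<open>q\<close>: a geometric sum over the
  powers of a q-th root of unity, which equals 1 exactly when q divides k.\<close>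

lemma sum_cis_residues:
  fixes k :: int
  assumes "q > 0"
  shows "(\<Sum>a<q. cis (2 * pi * (real_of_int k * (real a / real q)))) =
    (if int q dvd k then of_nat q else 0)"
proof -
  define w where "w = cis (2 * pi * (real_of_int k / real q))"
  have w: "cis (2 * pi * (real_of_int k * (real a / real q))) = w ^ a" for a
    unfolding w_def Complex.DeMoivre by (rule arg_cong[of _ _ cis]) simp
  have "w ^ q = cis (2 * pi * real_of_int k)"
    using assms by (simp add: w_def Complex.DeMoivre)
  also have "\<dots> = 1" by (rule cis_multiple_2pi) simp
  finally have wq: "w ^ q = 1" .
  have w1: "w = 1 \<longleftrightarrow> int q dvd k"
  proof
    assume "w = 1"
    then obtain n where "2 * pi * (real_of_int k / real q) = of_int n * (2 * pi)"
      unfolding w_def cis_eq_1_iff by blast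
    then have "real_of_int k = real_of_int n * real q" using assms by (simp add: field_simps)
    then have "k = n * int q" by (metis of_int_eq_iff of_int_mult of_int_of_nat_eq)
    then show "int q dvd k" by simp
  next
    assume "int q dvd k"
    then obtain n where "k = int q * n" by blast
    then have "w = cis (2 * pi * real_of_int n)" using assms by (simp add: w_def)
    also have "\<dots> = 1" by (rule cis_multiple_2pi) simp
    finally show "w = 1" .
  qed
  show ?thesis
    unfolding w
  proof (cases "w = 1")
    case True
    then show "(\<Sum>a<q. w ^ a) = (if int q dvd k then of_nat q else 0)" using w1 by simp
  next
    case False
    then have "(\<Sum>a<q. w ^ a) = 0" using wq by (simp add: geometric_sum)
    then show "(\<Sum>a<q. w ^ a) = (if int q dvd k then of_nat q else 0)" using w1 False by simp
  qed
qed

text \<open>Expand the squared modulus into a sum over pairs; orthogonality keeps the pairs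
  congruent modulo \<open>q\<close>.\<close>

lemma exp_sum_parseval:
  assumes "q > 0" "finite A"
  shows "(\<Sum>a<q. (cmod (exp_sum A (real a / real q)))\<^sup>2) =
    real q * real (card {(m, n) \<in> A \<times> A. int q dvd int m - int n})"
proof -
  have sq: "complex_of_real ((cmod (exp_sum A y))\<^sup>2) =
      (\<Sum>(m, n)\<in>A \<times> A. cis (2 * pi * (real_of_int (int m - int n) * y)))" for y
  proof -
    have "complex_of_real ((cmod (exp_sum A y))\<^sup>2) = exp_sum A y * cnj (exp_sum A y)"
      by (rule complex_norm_square)
    also have "\<dots> = (\<Sum>m\<in>A. \<Sum>n\<in>A. cis (2 * pi * (real m * y)) * cis (- (2 * pi * (real n * y))))"
      by (simp add: exp_sum_def sum_product cis_cnj)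
    also have "\<dots> = (\<Sum>m\<in>A. \<Sum>n\<in>A. cis (2 * pi * (real_of_int (int m - int n) * y)))"
      by (intro sum.cong refl) (simp add: cis_mult algebra_simps)
    finally show ?thesis by (simp add: sum.cartesian_product)
  qed
  have "complex_of_real (\<Sum>a<q. (cmod (exp_sum A (real a / real q)))\<^sup>2) =
      (\<Sum>a<q. \<Sum>(m, n)\<in>A \<times> A. cis (2 * pi * (real_of_int (int m - int n) * (real a / real q))))"
    unfolding of_real_sum sq ..
  also have "\<dots> = (\<Sum>(m, n)\<in>A \<times> A. if int q dvd int m - int n then of_nat q else 0)"
    unfolding case_prod_unfold by (subst sum.swap) (simp only: sum_cis_residues[OF assms(1)])
  also have "\<dots> = (\<Sum>p\<in>{(m, n) \<in> A \<times> A. int q dvd int m - int n}. of_nat q)"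
    using assms(2) by (intro sum.mono_neutral_cong_right) (auto split: if_splits)
  also have "\<dots> = complex_of_real (real q * real (card {(m, n) \<in> A \<times> A. int q dvd int m - int n}))"
    by simp
  finally show ?thesis by (simp only: of_real_eq_iff)
qed

text \<open>Each admissible numerator contributes at least (M/2)^(2t) to the Parseval sum modulo
  \<open>q\<close>. Summed over q, the diagonal pairs count for every q, and a pair m \<noteq> n
  only for the divisors q of m - n.\<close>

lemma sum_card_digit_numerators:
  assumes b: "b \<ge> 2" "M \<le> b" "6 * M * c \<le> b" "M > 0"
    and C: "C \<ge> 0" "\<And>n::nat. 0 < n \<Longrightarrow> n < b ^ t \<Longrightarrow> real (card {d. d dvd n}) \<le> C"
  shows "(\<Sum>q=1..N. real (card {a. a < q \<and> real a / real q \<in> digit_set b c})) \<le>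
    4 ^ t * (real N ^ 2 / real M ^ t + real N * C)"
proof -
  let ?S = "digit_ints b M t"
  let ?A = "\<lambda>q. {a. a < q \<and> real a / real q \<in> digit_set b c}"
  let ?P = "\<lambda>q. {(m, n) \<in> ?S \<times> ?S. int q dvd int m - int n}"
  let ?E = "{(m, n) \<in> ?S \<times> ?S. m \<noteq> n}"
  have fin: "finite ?S" by (rule finite_digit_ints)
  then have finE: "finite ?E" by (auto intro: finite_subset[of _ "?S \<times> ?S"])
  have "card ?E \<le> card (?S \<times> ?S)" using fin by (intro card_mono) auto
  then have cardE: "card ?E \<le> M ^ t * M ^ t"
    using card_digit_ints[OF b(2)] by (simp add: card_cartesian_product)
  have A: "real (card (?A q)) * ((real M / 2) ^ t)\<^sup>2 \<le> real q * real (card (?P q))" if "q > 0" for q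
  proof -
    have "real (card (?A q)) * ((real M / 2) ^ t)\<^sup>2 = (\<Sum>a\<in>?A q. ((real M / 2) ^ t)\<^sup>2)"
      by simp
    also have "\<dots> \<le> (\<Sum>a\<in>?A q. (cmod (exp_sum ?S (real a / real q)))\<^sup>2)"
      by (intro sum_mono power_mono norm_exp_sum_digit_ints_ge[OF b]) auto
    also have "\<dots> \<le> (\<Sum>a<q. (cmod (exp_sum ?S (real a / real q)))\<^sup>2)"
      by (intro sum_mono2) auto
    finally show ?thesis unfolding exp_sum_parseval[OF that fin] .
  qed
  have P: "real (card (?P q)) \<le> real M ^ t + (\<Sum>(m, n)\<in>?E. if int q dvd int m - int n then 1 else 0)" for q
  proof -
    have "?P q \<subseteq> (\<lambda>n. (n, n)) ` ?S \<union> {(m, n) \<in> ?E. int q dvd int m - int n}" by auto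
    then have "card (?P q) \<le> card ((\<lambda>n. (n, n)) ` ?S \<union> {(m, n) \<in> ?E. int q dvd int m - int n})"
      using fin finE by (intro card_mono finite_UnI) (auto intro: finite_subset[OF _ finE])
    also have "\<dots> \<le> card ((\<lambda>n. (n, n)) ` ?S) + card {(m, n) \<in> ?E. int q dvd int m - int n}"
      by (rule card_Un_le)
    also have "card ((\<lambda>n. (n, n)) ` ?S) \<le> M ^ t"
      using card_image_le[OF fin, of "\<lambda>n. (n, n)"] card_digit_ints[OF b(2)] by simp
    finally have "real (card (?P q)) \<le> real (M ^ t + card {(m, n) \<in> ?E. int q dvd int m - int n})"
      by (simp only: of_nat_le_iff add_le_mono1)
    also have "\<dots> = real M ^ t + (\<Sum>p\<in>{(m, n) \<in> ?E. int q dvd int m - int n}. 1)"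
      by simp
    also have "(\<Sum>p\<in>{(m, n) \<in> ?E. int q dvd int m - int n}. 1) =
        (\<Sum>(m, n)\<in>?E. if int q dvd int m - int n then 1 else 0 :: real)"
      using finE by (intro sum.mono_neutral_cong_left) (auto split: if_splits)
    finally show ?thesis .
  qed
  \<comment> \<open>After exchanging the sums, the moduli counted for an off-diagonal pair are
    divisors of k = |m - n|, which is positive and below b^t, so there are at most \<open>C\<close>
    of them.\<close>
  have E: "(\<Sum>q=1..N. if int q dvd int m - int n then 1 else 0 :: real) \<le> C" if "(m, n) \<in> ?E" for m n
  proof -
    define k where "k = nat \<bar>int m - int n\<bar>"
    have "m < b ^ t" "n < b ^ t"
      using that digit_ints_less[of M b] b by auto
    then have k: "0 < k" "k < b ^ t" using that unfolding k_def by auto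
    have dvd: "int q dvd int m - int n \<longleftrightarrow> q dvd k" for q
      by (simp add: k_def nat_dvd_iff flip: int_dvd_int_iff)
    have "(\<Sum>q=1..N. if int q dvd int m - int n then 1 else 0 :: real) =
        (\<Sum>q\<in>{q\<in>{1..N}. q dvd k}. 1)"
      unfolding dvd by (intro sum.mono_neutral_cong_right) auto
    also have "\<dots> \<le> real (card {d. d dvd k})"
      using k by (auto intro!: card_mono)
    also have "\<dots> \<le> C" using C k by blast
    finally show ?thesis .
  qed
  have "(\<Sum>q=1..N. real (card (?A q))) * ((real M / 2) ^ t)\<^sup>2 \<le>
      (\<Sum>q=1..N. real N * real (card (?P q)))"
    unfolding sum_distrib_right
    by (intro sum_mono order_trans[OF A] mult_right_mono) auto
  also have "\<dots> \<le> (\<Sum>q=1..N. real N *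
      (real M ^ t + (\<Sum>(m, n)\<in>?E. if int q dvd int m - int n then 1 else 0)))"
    by (intro sum_mono mult_left_mono P) auto
  also have "\<dots> = real N * (real N * real M ^ t +
      (\<Sum>q=1..N. \<Sum>(m, n)\<in>?E. if int q dvd int m - int n then 1 else 0))"
    by (simp add: sum.distrib flip: sum_distrib_left)
  also have "(\<Sum>q=1..N. \<Sum>(m, n)\<in>?E. if int q dvd int m - int n then 1 else 0 :: real) =
      (\<Sum>(m, n)\<in>?E. \<Sum>q=1..N. if int q dvd int m - int n then 1 else 0)"
    by (subst sum.swap) (simp only: case_prod_unfold)
  also have "real N * (real N * real M ^ t +
      (\<Sum>(m, n)\<in>?E. \<Sum>q=1..N. if int q dvd int m - int n then 1 else 0)) \<le>
      real N * (real N * real M ^ t + (\<Sum>p\<in>?E. C))"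
    by (intro mult_left_mono add_left_mono sum_mono) (use E in auto)
  also have "\<dots> \<le> real N * (real N * real M ^ t + real M ^ t * real M ^ t * C)"
  proof -
    have "real (card ?E) \<le> real M ^ t * real M ^ t"
      using of_nat_mono[OF cardE, where ?'a = real] by (simp only: of_nat_mult of_nat_power)
    then have "(\<Sum>p\<in>?E. C) \<le> real M ^ t * real M ^ t * C"
      using C(1) by (simp only: sum_constant) (rule mult_right_mono)
    then show ?thesis by (intro mult_left_mono add_left_mono) auto
  qed
  finally have *: "(\<Sum>q=1..N. real (card (?A q))) * ((real M / 2) ^ t)\<^sup>2 \<le>
      real N * (real N * real M ^ t + real M ^ t * real M ^ t * C)" .
  have two: "(2 ^ t) * (2 ^ t) = (4 ^ t :: real)" by (simp flip: power_mult_distrib)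
  \<comment> \<open>Dividing by (M/2)^(2t) = M^(2t) / 4^t produces the factor 4^t.\<close>
  have "real N * (real N * real M ^ t + real M ^ t * real M ^ t * C) =
      4 ^ t * (real N ^ 2 / real M ^ t + real N * C) * ((real M / 2) ^ t)\<^sup>2"
    using b(4) by (simp add: field_simps power2_eq_square flip: two)
  then show ?thesis using * b(4) by (simp only: mult_le_cancel_right) auto
qed

section \<open>Hausdorff dimension\<close>

text \<open>For diameters at most 1, lowering the exponent only enlarges the sum. The lower bound at
  \<open>s0\<close> thus holds for every s \<le> s0, and already the scale \<delta> = 1 makes those
  measures positive.\<close>

lemma hausdorff_dim_geI:
  fixes A :: "'a::metric_space set"
  assumes "\<kappa> > 0"
    and "\<And>C :: nat \<Rightarrow> 'a set. A \<subseteq> (\<Union>n. C n) \<Longrightarrow> (\<And>n. bounded (C n)) \<Longrightarrow>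
      (\<And>n. diameter (C n) \<le> 1) \<Longrightarrow> ennreal \<kappa> \<le> (\<Sum>n. ennreal (diameter (C n) powr s0))"
  shows "ereal s0 \<le> hausdorff_dim A"
  unfolding hausdorff_dim_def
proof (rule Inf_greatest)
  fix z assume "z \<in> {ereal s |s. 0 < s \<and> hausdorff_measure s A = 0}"
  then obtain s where s: "z = ereal s" "s > 0" "hausdorff_measure s A = 0" by blast
  show "ereal s0 \<le> z"
  proof (rule ccontr)
    assume "\<not> ereal s0 \<le> z"
    then have "s \<le> s0" using s by simp
    have "ennreal \<kappa> \<le> hausdorff_delta s 1 A"
      unfolding hausdorff_delta_def
    proof (rule INF_greatest)
      fix C :: "nat \<Rightarrow> 'a set"
      assume "C \<in> {C. A \<subseteq> (\<Union>n. C n) \<and> (\<forall>n. bounded (C n) \<and> diameter (C n) \<le> 1)}"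
      then have C: "A \<subseteq> (\<Union>n. C n)" "\<And>n. bounded (C n)" "\<And>n. diameter (C n) \<le> 1" by auto
      have "ennreal \<kappa> \<le> (\<Sum>n. ennreal (diameter (C n) powr s0))"
        using assms(2) C by blast
      also have "\<dots> \<le> (\<Sum>n. ennreal (diameter (C n) powr s))"
        using C \<open>s \<le> s0\<close> by (intro suminf_le ennreal_leI powr_mono') (auto simp: diameter_ge_0)
      finally show "ennreal \<kappa> \<le> (\<Sum>n. ennreal (diameter (C n) powr s))" .
    qed
    also have "\<dots> \<le> hausdorff_measure s A"
      unfolding hausdorff_measure_def by (rule SUP_upper) simp
    finally show False using s(3) assms(1) by simp
  qed
qed

text \<open>The box centred at any point of \<open>E\<close> with half-sides \<open>w i\<close>
  contains \<open>E\<close>; it serves as a measurable hull, as \<open>E\<close> may fail to be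
  measurable.\<close>

lemma emeasure_box_cover:
  fixes E :: "(real ^ 'n::finite) set" and w :: "'n \<Rightarrow> real"
  assumes "\<And>z z' i. z \<in> E \<Longrightarrow> z' \<in> E \<Longrightarrow> \<bar>z $ i - z' $ i\<bar> \<le> w i"
  obtains B where "B \<in> sets lborel" "E \<subseteq> B" "emeasure lborel B \<le> ennreal (\<Prod>i\<in>UNIV. 2 * w i)"
proof (cases "E = {}")
  case True
  then show thesis using that[of "{}"] by simp
next
  case False
  then obtain p where p: "p \<in> E" by blast
  have w: "w i \<ge> 0" for i using assms[OF p p, of i] by simp
  let ?l = "\<chi> i. p $ i - w i" and ?u = "\<chi> i. p $ i + w i"
  have "p \<in> cbox ?l ?u" using w by (simp add: mem_box_cart)
  then have "measure lborel (cbox ?l ?u) = (\<Prod>i\<in>UNIV. ?u $ i - ?l $ i)"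
    by (intro content_cbox_cart) auto
  also have "\<dots> = (\<Prod>i\<in>UNIV. 2 * w i)" by (intro prod.cong) auto
  finally have "emeasure lborel (cbox ?l ?u) = ennreal (\<Prod>i\<in>UNIV. 2 * w i)"
    using emeasure_lborel_cbox_finite[of ?l ?u] by (simp add: emeasure_eq_ennreal_measure)
  moreover have "E \<subseteq> cbox ?l ?u"
  proof
    fix z assume "z \<in> E"
    then have "\<bar>p $ i - z $ i\<bar> \<le> w i" for i using assms[OF p] by blast
    then have "p $ i - w i \<le> z $ i" "z $ i \<le> p $ i + w i" for i
      by (simp_all add: abs_le_iff algebra_simps)
    then show "z \<in> cbox ?l ?u" by (simp add: mem_box_cart)
  qed
  ultimately show thesis using that[of "cbox ?l ?u"] by simp
qed

text \<open>Rereading the digits of coordinate \<open>j0\<close> in base \<open>c\<close> maps the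
  set onto the unit cube, and a piece of diameter r goes into a box of measure at most c0
  r^(k-1+\<delta>), with k = CARD('n). The boxes cover the cube, so the sum of these powers is at
  least 1/c0.\<close>

lemma hausdorff_dim_digit_product_ge:
  fixes j0 :: "'n::finite"
  assumes "c \<ge> 2" "2 * c \<le> b" "real c = real b powr \<delta>"
  shows "ereal (real CARD('n) - 1 + \<delta>) \<le>
    hausdorff_dim {x :: real ^ 'n. \<forall>i. x $ i \<in> (if i = j0 then digit_set b c else {0..1})}"
    (is "_ \<le> hausdorff_dim ?K")
proof -
  \<comment> \<open>The box has k - 1 sides 2r and one side 2 (2 b r)^\<delta>.\<close>
  define c0 where "c0 = 2 ^ CARD('n) * (2 * real b) powr \<delta>"
  have c0: "c0 > 0" using assms by (simp add: c0_def)
  have prod: "(\<Prod>i\<in>UNIV. 2 * (if i = j0 then (2 * real b * r) powr \<delta> else r)) =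
      c0 * r powr (real CARD('n) - 1 + \<delta>)" if "r \<ge> 0" for r
  \<comment> \<open>Pieces of diameter 0 are separate because \<open>0 powr x = 0\<close> for every
    x, whereas \<open>0 ^ 0 = 1\<close>; the factor at \<open>j0\<close> makes the product vanish
    too.\<close>
  proof (cases "r = 0")
    case True
    have "(\<Prod>i\<in>UNIV. 2 * (if i = j0 then (2 * real b * r) powr \<delta> else r)) = 0"
      using True by (subst prod_zero_iff) auto
    then show ?thesis using True by simp
  next
    case False
    then have r: "r > 0" using that by simp
    have "(\<Prod>i\<in>UNIV. 2 * (if i = j0 then (2 * real b * r) powr \<delta> else r)) =
        2 ^ CARD('n) * ((2 * real b * r) powr \<delta> * r ^ (CARD('n) - 1))"
      by (simp add: prod.distrib prod.remove[of UNIV j0] card_Diff_singleton)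
    also have "r ^ (CARD('n) - 1) = r powr (real CARD('n) - 1)"
      using r by (simp add: of_nat_diff flip: powr_realpow)
    finally show ?thesis using r by (simp add: c0_def powr_mult powr_add)
  qed
  show ?thesis
  proof (rule hausdorff_dim_geI[where \<kappa> = "1 / c0"])
    fix C :: "nat \<Rightarrow> (real ^ 'n) set"
    assume C: "?K \<subseteq> (\<Union>n. C n)" "\<And>n. bounded (C n)" "\<And>n. diameter (C n) \<le> 1"
    \<comment> \<open>The change of base as a relation: one digit sequence represents
      \<open>x $ j0\<close> in base \<open>b\<close> and \<open>z $ j0\<close> in base
      \<open>c\<close>.\<close>
    define rel where "rel z x \<longleftrightarrow> (\<forall>i. i \<noteq> j0 \<longrightarrow> x $ i = z $ i) \<and>
        (\<exists>d. (\<forall>j. d j < c) \<and> (\<lambda>j. real (d j) / real c ^ Suc j) sums (z $ j0) \<and>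
          (\<lambda>j. real (d j) / real b ^ Suc j) sums (x $ j0))" for z x :: "real ^ 'n"
    define E where "E n = {z. \<exists>x\<in>C n. rel z x}" for n
    have E: "\<bar>z $ i - z' $ i\<bar> \<le> (if i = j0 then (2 * real b * diameter (C n)) powr \<delta> else diameter (C n))"
      if z: "z \<in> E n" "z' \<in> E n" for n z z' i
    proof -
      obtain x x' where x: "x \<in> C n" "rel z x" "x' \<in> C n" "rel z' x'"
        using z by (auto simp: E_def)
      have "dist x x' \<le> diameter (C n)" using C(2) x by (intro diameter_bounded_bound)
      then have xi: "\<bar>x $ i - x' $ i\<bar> \<le> diameter (C n)" for i
        using component_le_norm_cart[of "x - x'" i] by (simp add: dist_norm)
      show ?thesis
      proof (cases "i = j0")
        case True
        obtain d where d: "\<forall>j. d j < c" "(\<lambda>j. real (d j) / real c ^ Suc j) sums (z $ j0)"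
          "(\<lambda>j. real (d j) / real b ^ Suc j) sums (x $ j0)"
          using x(2) unfolding rel_def by auto
        obtain d' where d': "\<forall>j. d' j < c" "(\<lambda>j. real (d' j) / real c ^ Suc j) sums (z' $ j0)"
          "(\<lambda>j. real (d' j) / real b ^ Suc j) sums (x' $ j0)"
          using x(4) unfolding rel_def by auto
        from digit_change_of_base_Hoelder[OF assms d(1)[rule_format] d'(1)[rule_format]
            d(3) d'(3) d(2) d'(2) xi]
        show ?thesis using True by simp
      next
        case False
        then show ?thesis using x xi[of i] by (simp add: rel_def)
      qed
    qed
    have "\<exists>B. B \<in> sets lborel \<and> E n \<subseteq> B \<and> emeasure lborel B \<le>
        ennreal (c0 * diameter (C n) powr (real CARD('n) - 1 + \<delta>))" for n
    proof -
      obtain B where "B \<in> sets lborel" "E n \<subseteq> B" "emeasure lborel B \<le> ennreal (\<Prod>i\<in>UNIV.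
          2 * (if i = j0 then (2 * real b * diameter (C n)) powr \<delta> else diameter (C n)))"
        by (rule emeasure_box_cover[of "E n" "\<lambda>i. if i = j0 then
              (2 * real b * diameter (C n)) powr \<delta> else diameter (C n)", OF E])
      then show ?thesis unfolding prod[OF diameter_ge_0[OF C(2)]] by blast
    qed
    then obtain B where B: "\<And>n. B n \<in> sets lborel" "\<And>n. E n \<subseteq> B n"
      "\<And>n. emeasure lborel (B n) \<le> ennreal (c0 * diameter (C n) powr (real CARD('n) - 1 + \<delta>))"
      by metis
    \<comment> \<open>Surjectivity: expand \<open>z $ j0\<close> in base \<open>c\<close> and reread
      the digits in base \<open>b\<close> to get a point of the set related to
      \<open>z\<close>.\<close>
    have cover: "cbox 0 1 \<subseteq> (\<Union>n. B n)"
    proof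
      fix z :: "real ^ 'n" assume "z \<in> cbox 0 1"
      then have z: "0 \<le> z $ i" "z $ i \<le> 1" for i by (auto simp: mem_box_cart)
      obtain d where d: "\<forall>j. d j < c" "(\<lambda>j. real (d j) / real c ^ Suc j) sums (z $ j0)"
        using digit_expansion_exists[OF assms(1) z] by blast
      have "summable (\<lambda>j. real (d j) / real b ^ Suc j)"
      proof (rule summable_comparison_test')
        show "summable (\<lambda>j. real (d j) / real c ^ Suc j)" using d(2) by (rule sums_summable)
        show "norm (real (d j) / real b ^ Suc j) \<le> real (d j) / real c ^ Suc j" if "j \<ge> 0" for j
          using assms(1,2) by (auto intro!: divide_left_mono mult_mono power_mono)
      qed
      then obtain v where v: "(\<lambda>j. real (d j) / real b ^ Suc j) sums v"
        by (auto simp: summable_def)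
      define x where "x = (\<chi> i. if i = j0 then v else z $ i)"
      have "x \<in> ?K" using d v z by (auto simp: x_def digit_set_def)
      then obtain n where "x \<in> C n" using C(1) by blast
      moreover have "rel z x" using d v by (auto simp: rel_def x_def)
      ultimately show "z \<in> (\<Union>n. B n)" using B(2)[of n] by (auto simp: E_def)
    qed
    have "measure lborel (cbox 0 (1 :: real ^ 'n)) = (\<Prod>i\<in>UNIV. (1 :: real ^ 'n) $ i - 0 $ i)"
      by (intro content_cbox_cart) (auto simp: interval_eq_empty_cart)
    moreover have "emeasure lborel (cbox 0 (1 :: real ^ 'n)) < top"
      using emeasure_lborel_cbox_finite[of 0 "1 :: real ^ 'n"] by simp
    ultimately have "1 = emeasure lborel (cbox 0 (1 :: real ^ 'n))"
      by (simp add: emeasure_eq_ennreal_measure)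
    also have "\<dots> \<le> emeasure lborel (\<Union>n. B n)"
      using cover B(1) by (intro emeasure_mono) auto
    also have "\<dots> \<le> (\<Sum>n. emeasure lborel (B n))"
      using B(1) by (intro emeasure_subadditive_countably) auto
    also have "\<dots> \<le> (\<Sum>n. ennreal c0 * ennreal (diameter (C n) powr (real CARD('n) - 1 + \<delta>)))"
      using B(3) c0 by (intro suminf_le) (auto simp: ennreal_mult)
    also have "\<dots> = ennreal c0 * (\<Sum>n. ennreal (diameter (C n) powr (real CARD('n) - 1 + \<delta>)))"
      by simp
    finally have "ennreal (1 / c0) * 1 \<le> ennreal (1 / c0) *
        (ennreal c0 * (\<Sum>n. ennreal (diameter (C n) powr (real CARD('n) - 1 + \<delta>))))"
      by (rule mult_left_mono) simp
    also have "\<dots> = ennreal (1 / c0 * c0) * (\<Sum>n. ennreal (diameter (C n) powr (real CARD('n) - 1 + \<delta>)))"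
      using c0 by (subst ennreal_mult) (simp_all only: mult.assoc, simp_all)
    finally show "ennreal (1 / c0) \<le> (\<Sum>n. ennreal (diameter (C n) powr (real CARD('n) - 1 + \<delta>)))"
      using c0 by simp
  qed (use c0 in simp)
qed

section \<open>Counting rational points\<close>

text \<open>For fixed q the numerator at \<open>j0\<close> is admissible for the restricted factor,
  and each of the other k - 1 numerators has q + 1 \<le> 2Q choices.\<close>

lemma card_rational_points_digit_product:
  fixes j0 :: "'n::finite"
  assumes "b \<ge> 2" "c < b" "Q \<ge> 1"
  shows "real (card (rational_points
      {x :: real ^ 'n. \<forall>i. x $ i \<in> (if i = j0 then digit_set b c else {0..1})} Q)) \<le>
    (2 * Q) ^ (CARD('n) - 1) *
    (\<Sum>q=1..nat \<lfloor>Q\<rfloor>. real (card {a. a < q \<and> real a / real q \<in> digit_set b c}))"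
    (is "real (card (rational_points ?K Q)) \<le> _")
proof -
  let ?N = "nat \<lfloor>Q\<rfloor>"
  let ?A = "\<lambda>q. {a. a < q \<and> real a / real q \<in> digit_set b c}"
  define F where "F q = (\<Pi>\<^sub>E i\<in>(UNIV :: 'n set). if i = j0 then int ` ?A q else {0..int q})" for q
  have finA: "finite (?A q)" for q by simp
  have finF: "finite (F q)" for q unfolding F_def by (intro finite_PiE) auto
  have cardF: "card (F q) = card (?A q) * Suc q ^ (CARD('n) - 1)" for q
  proof -
    have "card (F q) = (\<Prod>i\<in>UNIV. card (if i = j0 then int ` ?A q else {0..int q}))"
      unfolding F_def by (intro card_PiE) simp
    also have "\<dots> = card (int ` ?A q) * (\<Prod>i\<in>UNIV - {j0}. Suc q)"
      by (subst prod.remove[of UNIV j0]) (auto simp: nat_add_distrib intro!: prod.cong)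
    finally show ?thesis by (simp add: card_image card_Diff_singleton)
  qed
  \<comment> \<open>The image on the right is finite, so the set of rational points is finite and
    its \<open>card\<close> is a true count, not the default 0.\<close>
  have sub: "rational_points ?K Q \<subseteq> (\<lambda>(q, a). (a, q)) ` (SIGMA q:{1..?N}. F q)"
  proof
    fix p assume "p \<in> rational_points ?K Q"
    then obtain a q where p: "p = (a, q)" "1 \<le> q" "real q \<le> Q"
      and K: "\<And>i. real_of_int (a i) / real q \<in> (if i = j0 then digit_set b c else {0..1})"
      by (auto simp: rational_points_def)
    have q: "q \<in> {1..?N}" using p by (auto simp: le_nat_floor)
    have "a i \<in> (if i = j0 then int ` ?A q else {0..int q})" for i
    proof (cases "i = j0")
      case True
      then have ai: "real_of_int (a i) / real q \<in> digit_set b c" using K[of i] by simp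
      then obtain d where "\<And>j. d j < c" "(\<lambda>j. real (d j) / real b ^ Suc j) sums (real_of_int (a i) / real q)"
        by (auto simp: digit_set_def)
      note bounds = digit_expansion_bounds[OF assms(1) less_imp_le[OF assms(2)] this]
      \<comment> \<open>This excludes the value 1, so the numerator is a residue in {0..<q} and
        falls under the Parseval count.\<close>
      have "real c / real b < 1" using assms by simp
      then have "real_of_int (a i) / real q < 1" using bounds by linarith
      then have "a i < int q" using p by (simp add: field_simps)
      moreover have "0 \<le> a i" using bounds(1) p by (simp add: zero_le_divide_iff)
      ultimately have "nat (a i) \<in> ?A q" "a i = int (nat (a i))" using ai by auto
      then show ?thesis using True by (metis image_eqI)
    next
      case False
      then show ?thesis using K[of i] p by (auto simp: field_simps)
    qed
    then have "a \<in> F q" by (auto simp: F_def)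
    then show "p \<in> (\<lambda>(q, a). (a, q)) ` (SIGMA q:{1..?N}. F q)"
      using p q by force
  qed
  have "card (rational_points ?K Q) \<le> card (SIGMA q:{1..?N}. F q)"
    using sub by (intro surj_card_le) (auto intro: finF)
  also have "\<dots> = (\<Sum>q=1..?N. card (?A q) * Suc q ^ (CARD('n) - 1))"
    by (subst card_SigmaI) (auto simp: finF cardF)
  finally have "real (card (rational_points ?K Q)) \<le>
      (\<Sum>q=1..?N. real (card (?A q)) * real (Suc q) ^ (CARD('n) - 1))"
    using of_nat_mono[where ?'a = real] by fastforce
  also have "\<dots> \<le> (\<Sum>q=1..?N. real (card (?A q)) * (2 * Q) ^ (CARD('n) - 1))"
  proof (intro sum_mono mult_left_mono power_mono)
    fix q assume "q \<in> {1..?N}"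
    then have "real q \<le> Q" using assms(3) by (simp add: le_nat_iff le_floor_iff)
    then show "real (Suc q) \<le> 2 * Q" using assms(3) by simp
  qed auto
  finally show ?thesis by (simp add: sum_distrib_left mult.commute)
qed

text \<open>Take M = 2^s and t with Q \<le> M^t \<le> M Q. The loss 4^t and the divisor bound below
  b^t then each cost at most (M^t)^(\<eta>/2), up to a constant.\<close>

lemma digit_set_numerators_bound:
  fixes \<eta> :: real
  assumes "\<eta> > 0" "R \<ge> 2" "s \<ge> 3" "4 \<le> real s * \<eta>"
  obtains C where "C > 0" "\<And>Q. Q \<ge> 1 \<Longrightarrow>
    (\<Sum>q=1..nat \<lfloor>Q\<rfloor>. real (card {a. a < q \<and>
      real a / real q \<in> digit_set (2 ^ ((s + 3) * R)) (2 ^ ((s + 3) * (R - 1)))})) \<le> C * Q powr (1 + \<eta>)"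
proof -
  define M :: nat where "M = 2 ^ s"
  define b :: nat where "b = 2 ^ ((s + 3) * R)"
  define c :: nat where "c = 2 ^ ((s + 3) * (R - 1))"
  have bc: "b = 8 * M * c"
  proof -
    \<comment> \<open>The summand 3 supplies the factor 8, a power of two exceeding the 6 required
      in 6 M c \<le> b.\<close>
    have "(s + 3) * R = 3 + s + (s + 3) * (R - 1)"
      using assms(2) by (cases R) auto
    then show ?thesis by (simp add: b_def c_def M_def power_add)
  qed
  have c: "c \<ge> 1" and M: "M \<ge> 2" using assms(3) self_le_power[of 2 s] by (auto simp: c_def M_def)
  have b: "b \<ge> 2" "M \<le> b" "6 * M * c \<le> b" "M > 0"
    using c M unfolding bc by (auto simp: Suc_le_eq)
  \<comment> \<open>The exponent is fitted to b^t \<le> (M^t)^(2R), which turns it into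
    \<eta>/2.\<close>
  obtain C0 where C0: "C0 > 0"
    "\<And>n::nat. n > 0 \<Longrightarrow> real (card {d. d dvd n}) \<le> C0 * real n powr (\<eta> / (4 * real R))"
    using divisor_bound[of "\<eta> / (4 * real R)"] assms(1,2) by auto
  have "(\<Sum>q=1..nat \<lfloor>Q\<rfloor>. real (card {a. a < q \<and> real a / real q \<in> digit_set b c})) \<le>
      ((1 + C0) * real M powr \<eta>) * Q powr (1 + \<eta>)" if Q: "Q \<ge> 1" for Q
  proof -
    define N where "N = nat \<lfloor>Q\<rfloor>"
    have N: "real N \<le> Q" using Q by (simp add: N_def)
    \<comment> \<open>The least t with Q \<le> M^t.\<close>
    define t where "t = nat \<lceil>log M Q\<rceil>"
    define X where "X = real M ^ t"
    have lQ: "0 \<le> log M Q" using Q M by simp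
    have "real M powr log M Q \<le> real M powr real t"
      using M lQ by (intro powr_mono) (auto simp: t_def)
    then have XQ: "Q \<le> X" using M Q by (simp add: X_def powr_realpow)
    have "real M powr real t \<le> real M powr (1 + log M Q)"
      using M lQ by (intro powr_mono) (simp_all add: t_def, linarith)
    then have XMQ: "X \<le> real M * Q" using M Q by (simp add: X_def powr_realpow powr_add)
    have X1: "X \<ge> 1" using XQ Q by simp
    have X2: "X = 2 powr (real s * real t)"
      by (simp add: X_def M_def powr_realpow flip: power_mult of_nat_mult)
    have "(4::real) ^ t = 2 powr (2 * real t)"
      by (simp add: powr_realpow power_mult flip: of_nat_mult powr_powr)
    also have "\<dots> \<le> 2 powr (real s * real t * (\<eta> / 2))"
    proof (intro powr_mono)
      have "2 * real t \<le> (real s * \<eta> / 2) * real t"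
        using assms(4) by (intro mult_right_mono) auto
      then show "2 * real t \<le> real s * real t * (\<eta> / 2)" by (simp add: mult_ac)
    qed simp
    finally have four: "4 ^ t \<le> X powr (\<eta> / 2)" by (simp add: X2 powr_powr)
    have "b ^ t \<le> (M ^ t) ^ (2 * R)"
    proof -
      \<comment> \<open>From s \<ge> 3: b = 2^((s+3)R) is at most 2^(2sR) = M^(2R).\<close>
      have "(s + 3) * R * t \<le> (s + s) * R * t" using assms(3) by (intro mult_le_mono) auto
      then have "(s + 3) * R * t \<le> s * t * (2 * R)" by (simp add: mult_ac)
      then show ?thesis
        unfolding b_def M_def power_mult[symmetric] by (intro power_increasing) auto
    qed
    then have "real (b ^ t) \<le> X ^ (2 * R)"
      unfolding X_def by (metis of_nat_le_iff of_nat_power)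
    then have "real (b ^ t) powr (\<eta> / (4 * real R)) \<le> (X ^ (2 * R)) powr (\<eta> / (4 * real R))"
      using assms(1) by (intro powr_mono2) auto
    also have "X ^ (2 * R) = X powr (2 * real R)"
      using X1 powr_realpow[of X "2 * R"] by simp
    also have "(X powr (2 * real R)) powr (\<eta> / (4 * real R)) = X powr (\<eta> / 2)"
      using assms(2) by (simp add: powr_powr)
    finally have bt: "real (b ^ t) powr (\<eta> / (4 * real R)) \<le> X powr (\<eta> / 2)" .
    have div: "real (card {d. d dvd n}) \<le> C0 * X powr (\<eta> / 2)" if "0 < n" "n < b ^ t" for n
    proof -
      have "real n powr (\<eta> / (4 * real R)) \<le> real (b ^ t) powr (\<eta> / (4 * real R))"
        using that(2) assms(1) by (intro powr_mono2) (simp_all only: of_nat_le_iff, auto)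
      then have "C0 * real n powr (\<eta> / (4 * real R)) \<le> C0 * X powr (\<eta> / 2)"
        using bt C0(1) by (intro mult_left_mono) auto
      then show ?thesis using C0(2)[OF that(1)] by linarith
    qed
    have "(\<Sum>q=1..N. real (card {a. a < q \<and> real a / real q \<in> digit_set b c})) \<le>
        4 ^ t * (real N ^ 2 / X + real N * (C0 * X powr (\<eta> / 2)))"
      unfolding X_def
      by (rule sum_card_digit_numerators[OF b]) (use C0 div in \<open>auto simp: X_def\<close>)
    also have "\<dots> \<le> X powr (\<eta> / 2) * (Q * X powr (\<eta> / 2) + Q * (C0 * X powr (\<eta> / 2)))"
    proof (intro mult_mono add_mono four)
      have "real N ^ 2 / X \<le> Q ^ 2 / Q"
        using N XQ Q by (intro frac_le power_mono) auto
      also have "\<dots> = Q" using Q by (simp add: power2_eq_square)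
      also have "\<dots> \<le> Q * X powr (\<eta> / 2)"
        using Q X1 assms(1) by (simp add: ge_one_powr_ge_zero)
      finally show "real N ^ 2 / X \<le> Q * X powr (\<eta> / 2)" .
    qed (use N Q X1 C0 in auto)
    also have "\<dots> = (1 + C0) * Q * X powr \<eta>"
      by (simp add: algebra_simps flip: powr_add)
    also have "\<dots> \<le> (1 + C0) * Q * (real M * Q) powr \<eta>"
      using XMQ X1 Q C0 assms(1) by (intro mult_left_mono powr_mono2) auto
    also have "\<dots> = ((1 + C0) * real M powr \<eta>) * Q powr (1 + \<eta>)"
      using Q by (simp add: powr_mult powr_add)
    finally show ?thesis unfolding N_def .
  qed
  then show thesis
    using C0 b(4) by (intro that[of "(1 + C0) * real M powr \<eta>"]) (auto simp: b_def c_def)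
qed

section \<open>Choice of the parameters and conclusion\<close>

theorem theorem1p15:
  fixes \<eta> :: real and j0 :: "'n::finite"
  assumes "\<eta> > 0"
  shows "\<exists>K :: (real ^ 'n) set.
           is_missing_digit_fractal K \<and>
           {x. (\<forall>i. 0 \<le> x $ i \<and> x $ i \<le> 1) \<and> x $ j0 = 0} \<subseteq> K \<and>
           (\<exists>C. \<forall>Q::real. Q \<ge> 1 \<longrightarrow>
               real (card (rational_points K Q)) \<le> C * Q powr (real CARD('n) + \<eta>)) \<and>
           hausdorff_dim K > ereal (real CARD('n) - \<eta>)"
proof -
  \<comment> \<open>R > 1/\<eta> gives the dimension bound k - 1 + \<delta> = k - 1/R > k - \<eta>;
    s \<ge> 4/\<eta> makes 4^t at most (2^(s t))^(\<eta>/2).\<close>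
  define R where "R = nat \<lceil>1 / \<eta>\<rceil> + 2"
  define s where "s = nat \<lceil>4 / \<eta>\<rceil> + 3"
  have R2: "R \<ge> 2" and s3: "s \<ge> 3" by (auto simp: R_def s_def)
  have "1 / \<eta> < real R" unfolding R_def by linarith
  then have R: "1 / real R < \<eta>" using assms R2 by (simp add: field_simps)
  have "4 / \<eta> \<le> real s" unfolding s_def by linarith
  then have s: "4 \<le> real s * \<eta>" using assms by (simp add: field_simps)
  \<comment> \<open>Exponents in the ratio R : (R - 1) make c = b^(1 - 1/R) an exact integer
    identity.\<close>
  define b :: nat where "b = 2 ^ ((s + 3) * R)"
  define c :: nat where "c = 2 ^ ((s + 3) * (R - 1))"
  define \<delta> where "\<delta> = 1 - 1 / real R"
  have "2 ^ 1 \<le> c" unfolding c_def using R2 by (intro power_increasing) auto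
  then have c2: "c \<ge> 2" by simp
  have "2 * c = 2 ^ Suc ((s + 3) * (R - 1))" by (simp add: c_def)
  also have "\<dots> \<le> b" unfolding b_def using R2 by (intro power_increasing) (auto simp: algebra_simps)
  finally have cb: "2 * c \<le> b" .
  have b2: "b \<ge> 2" and c_less: "c < b" using c2 cb by auto
  have "real b powr \<delta> = 2 powr (real ((s + 3) * R) * \<delta>)"
    unfolding b_def by (simp add: powr_powr flip: powr_realpow)
  also have "real ((s + 3) * R) * \<delta> = real ((s + 3) * (R - 1))"
    using R2 by (simp add: \<delta>_def field_simps of_nat_diff)
  also have "2 powr \<dots> = real c" by (subst powr_realpow) (simp_all add: c_def)
  finally have c_powr: "real c = real b powr \<delta>" ..

  define g where "g i = (if i = j0 then c else b)" for i
  define K where "K = {x :: real ^ 'n. \<forall>i. x $ i \<in> (if i = j0 then digit_set b c else {0..1})}"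
  have "missing_digit_set b {d. \<forall>i. d i < g i} = {x :: real ^ 'n. \<forall>i. x $ i \<in> digit_set b (g i)}"
    by (rule missing_digit_set_box)
  also have "\<dots> = K"
    unfolding K_def g_def by (intro Collect_cong all_cong1) (simp add: digit_set_full[OF b2])
  finally have K: "K = missing_digit_set b {d. \<forall>i. d i < g i}" by simp
  have fractal: "is_missing_digit_fractal K"
    unfolding is_missing_digit_fractal_def
  proof (intro exI conjI ballI allI)
    have "(\<lambda>_. 0) \<in> {d. \<forall>i. d i < g i}" using c2 b2 by (simp add: g_def)
    then show "{d. \<forall>i. d i < g i} \<noteq> {}" by (metis empty_iff)
    fix d i assume "d \<in> {d. \<forall>i. d i < g i}"
    then have "d i < g i" by simp
    also have "g i \<le> b" using c_less by (simp add: g_def)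
    finally show "d i < b" .
  qed (fact b2 K)+
  \<comment> \<open>The digit 0 is allowed in coordinate \<open>j0\<close> and the other coordinates
    are unrestricted, so the whole face lies in \<open>K\<close>.\<close>
  have "0 \<in> digit_set b c"
    using c2 unfolding digit_set_def by (auto intro!: exI[of _ "\<lambda>_. 0"])
  then have face: "{x. (\<forall>i. 0 \<le> x $ i \<and> x $ i \<le> 1) \<and> x $ j0 = 0} \<subseteq> K"
    by (auto simp: K_def)
  obtain C where C: "C > 0" "\<And>Q. Q \<ge> 1 \<Longrightarrow>
      (\<Sum>q=1..nat \<lfloor>Q\<rfloor>. real (card {a. a < q \<and> real a / real q \<in> digit_set b c})) \<le> C * Q powr (1 + \<eta>)"
    using digit_set_numerators_bound[OF assms R2 s3 s] unfolding b_def c_def by blast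
  have count: "real (card (rational_points K Q)) \<le>
      (2 ^ (CARD('n) - 1) * C) * Q powr (real CARD('n) + \<eta>)" if Q: "Q \<ge> 1" for Q
  proof -
    have "real (card (rational_points K Q)) \<le> (2 * Q) ^ (CARD('n) - 1) *
        (\<Sum>q=1..nat \<lfloor>Q\<rfloor>. real (card {a. a < q \<and> real a / real q \<in> digit_set b c}))"
      unfolding K_def by (rule card_rational_points_digit_product[OF b2 c_less Q])
    also have "\<dots> \<le> (2 * Q) ^ (CARD('n) - 1) * (C * Q powr (1 + \<eta>))"
      using Q by (intro mult_left_mono C) auto
    also have "(2 * Q) ^ (CARD('n) - 1) = 2 ^ (CARD('n) - 1) * Q powr (real CARD('n) - 1)"
      using Q by (simp add: power_mult_distrib of_nat_diff Suc_leI flip: powr_realpow)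
    also have "\<dots> * (C * Q powr (1 + \<eta>)) =
        (2 ^ (CARD('n) - 1) * C) * (Q powr (real CARD('n) - 1) * Q powr (1 + \<eta>))"
      by simp
    also have "Q powr (real CARD('n) - 1) * Q powr (1 + \<eta>) = Q powr (real CARD('n) + \<eta>)"
      by (simp flip: powr_add)
    finally show ?thesis .
  qed
  have "ereal (real CARD('n) - \<eta>) < ereal (real CARD('n) - 1 + \<delta>)"
    using R by (simp add: \<delta>_def)
  also have "\<dots> \<le> hausdorff_dim K"
    unfolding K_def by (rule hausdorff_dim_digit_product_ge[OF c2 cb c_powr])
  finally show ?thesis using fractal face count by blast
qed

end
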